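(* Let $q$ be an odd prime power, $\mathbb F_q$ the finite field of order $q$, $d$ a positive integer, and $A\subset \mathbb F_q^d$. Let $\mathcal{SQ}(A)$ and $\mathcal{ZR}(A)$ be the number of pairs $(x,y)\in A\times A$ such that $\eta(\|x-y\|)=1$ and the number of pairs with $\eta(\|x-y\|)=0$, respectively. Then: \begin{enumerate} \item If $d\equiv 3 \pmod 4$ and $q\equiv 3\pmod 4$, then $$\mathcal{SQ}(A)+\mathcal{ZR}(A) \le \frac{|A|^2}{2} +\frac{|A|^2}{2q} - \frac{|A|^2}{2 q^{\frac{d-1}{2}}} - \frac{|A|^2}{2 q^{\frac{d+1}{2}}}+ q^{\frac{d-1}{2}} |A|.$$ \item If $d\equiv 1 \pmod 4$, or $d\equiv 3 \pmod 4$ and $q\equiv 1\pmod 4$, then $$\mathcal{SQ}(A)+\mathcal{ZR}(A) \le \frac{|A|^2}{2} +\frac{|A|^2}{2q}+ \frac{q^{\frac{d+1}{2}} |A|}{2} -\frac{q^{\frac{d-1}{2}} |A|}{2}.$$ \item If $d\equiv 2 \pmod 4$ and $q\equiv 3\pmod 4$, then $$\mathcal{SQ}(A)+\mathcal{ZR}(A) \le \frac{|A|^2}{2} +\frac{|A|^2}{2q}-\frac{|A|^2}{q^{\frac{d}{2}}}+ \frac{q^{\frac{d}{2}} |A|}{2} +\frac{q^{\frac{d-2}{2}}|A|}{2}.$$ \item If $d\equiv 0 \pmod 4$, or $d\equiv 2 \pmod 4$ and $q\equiv 1\pmod 4$, then $$\mathcal{SQ}(A)+\mathcal{ZR}(A)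 \le \frac{|A|^2}{2} +\frac{|A|^2}{2q}+ \frac{q^{\frac{d}{2}} |A|}{2}-\frac{q^{\frac{d-2}{2}}|A|}{2}.$$ \end{enumerate}
   Context: For $x,y\in\mathbb F_q^d$, $\|x-y\|:=(x_1-y_1)^2+\cdots+(x_d-y_d)^2\in\mathbb F_q$. $\eta$ denotes the quadratic character of $\mathbb F_q$ (so $\eta(a)=1$ if $a$ is a nonzero square, $\eta(a)=-1$ if $a$ is a non-square) with the convention $\eta(0)=0$. *)

theory Defs
  imports "HOL-Analysis.Finite_Cartesian_Product"
begin

definition qchar :: "'a::{finite,field} \<Rightarrow> int" where
  "qchar a = (if a = 0 then 0 else if (\<exists>b. b ^ 2 = a) then 1 else -1)"

definition fdist :: "'a::{finite,field} ^ 'n \<Rightarrow> 'a ^ 'n \<Rightarrow> 'a" where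
  "fdist x y = (\<Sum>i\<in>UNIV. (x $ i - y $ i) ^ 2)"

definition SQ :: "('a::{finite,field} ^ 'n) set \<Rightarrow> nat" where
  "SQ A = card {(x, y). x \<in> A \<and> y \<in> A \<and> qchar (fdist x y) = 1}"

definition ZR :: "('a::{finite,field} ^ 'n) set \<Rightarrow> nat" where
  "ZR A = card {(x, y). x \<in> A \<and> y \<in> A \<and> qchar (fdist x y) = 0}"

end

theory Submission
  imports Defs "HOL-Library.FuncSet" "HOL-Computational_Algebra.Primes"
begin

text \<open>
  Put \<open>K t = \<eta> t + [t = 0]\<close>, so that \<open>SQ A + ZR A = |A|^2/2 + 1/2 * (sum of K(|x-y|) over A \<times> A)\<close>.
  Completing the square shows that the Fourier transform on \<open>F_q^d\<close> of \<open>e(s|x|)\<close> is a power of a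
  Gauss sum times a function of the same kind. With \<open>B t = q[t = 0] - 1\<close>, \<open>\<delta> = \<eta>(-1)\<close> and
  \<open>gauss^2 = \<delta> q\<close>, it follows that \<open>K - 1/q\<close> is the transform of
  \<open>\<delta>^k q^(-k-1) (B + \<eta>)\<close> when \<open>d = 2k + 1\<close>, and of \<open>\<delta>^k q^(-k) (\<delta> \<eta> + B/q)\<close> when \<open>d = 2k\<close>.
  Bounding these eigenvalues by their maximum at every nonzero frequency, treating the zero
  frequency exactly, and applying Parseval's identity gives the four estimates.
\<close>

section \<open>Parity of finite sets and odd characteristic\<close>

text \<open>An involution without fixed points splits the set into two-element orbits; the induction
  removes one orbit \<open>{x, f x}\<close> at a time.\<close>

lemma even_card_involution:
  assumes "finite S" "\<And>x. x \<in> S \<Longrightarrow> f x \<in> S" "\<And>x. x \<in> S \<Longrightarrow> f (f x) = x"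
    and "\<And>x. x \<in> S \<Longrightarrow> f x \<noteq> x"
  shows "even (card S)"
  using assms
proof (induction S rule: finite_psubset_induct)
  case (psubset S)
  show ?case
  proof (cases "S = {}")
    case False
    then obtain x where x: "x \<in> S" by blast
    let ?T = "S - {x, f x}"
    have "even (card ?T)"
    proof (rule psubset.IH)
      show "f y \<in> ?T" if "y \<in> ?T" for y
        using that x psubset.prems by (metis Diff_iff insert_iff empty_iff)
    qed (use x psubset.prems in auto)
    moreover have "card S = card ?T + 2"
    proof -
      have "S = insert x (insert (f x) ?T)" using x psubset.prems by auto
      moreover have "x \<notin> insert (f x) ?T" "f x \<notin> ?T" using psubset.prems(3)[OF x] by auto
      ultimately show ?thesis using psubset.hyps
        by (metis (no_types, lifting) add_2_eq_Suc' card_insert_disjoint finite_Diff finite_insert)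
    qed
    ultimately show ?thesis by simp
  qed simp
qed

text \<open>In characteristic 2 the translation \<open>x + 1\<close> would be an involution of the
  field without fixed points, forcing even order.\<close>

lemma odd_card_two_neq_zero:
  assumes "odd CARD('a::{finite,field})"
  shows "(2::'a) \<noteq> 0"
proof
  assume two: "(2::'a) = 0"
  have "x + 1 + 1 = x" for x :: 'a
    using two by (metis add.assoc add.right_neutral one_add_one)
  then have "even (card (UNIV :: 'a set))"
    by (intro even_card_involution[of _ "\<lambda>x. x + 1"]) auto
  with assms show False by simp
qed

section \<open>The quadratic character\<close>

lemma qchar_0 [simp]: "qchar 0 = 0"
  by (simp add: qchar_def)

lemma qchar_1 [simp]: "qchar 1 = 1"
  by (auto simp: qchar_def intro: exI[of _ 1])

context
  assumes two: "(2::'a::{finite,field}) \<noteq> 0"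
begin

lemma minus_neq_self:
  assumes "x \<noteq> (0::'a)" shows "- x \<noteq> x"
proof
  assume "- x = x"
  then have "2 * x = 0" by (metis add.right_inverse mult_2)
  with two assms show False by simp
qed

lemma four_neq_zero: "(4::'a) \<noteq> 0"
proof -
  have "(4::'a) = 2 * 2" by simp
  then show ?thesis using two by (metis mult_eq_0_iff)
qed

lemma card_square_roots:
  fixes u :: 'a
  shows "int (card {t. t\<^sup>2 = u}) = 1 + qchar u"
proof -
  consider "u = 0" | b where "u \<noteq> 0" "b\<^sup>2 = u" | "u \<noteq> 0" "\<nexists>b. b\<^sup>2 = u" by blast
  then show ?thesis
  proof cases
    case 1
    then have "{t. t\<^sup>2 = u} = {0}" by auto
    with 1 show ?thesis by (simp add: qchar_def)
  next
    case 2
    have "b \<noteq> 0" using 2 by auto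
    have "{t. t\<^sup>2 = u} = {b, - b}" using 2 power2_eq_iff by auto
    moreover have "card {b, - b} = 2" using minus_neq_self[OF \<open>b \<noteq> 0\<close>] by simp
    moreover have "qchar u = 1" using 2 by (auto simp: qchar_def)
    ultimately show ?thesis by simp
  next
    case 3
    then show ?thesis by (simp add: qchar_def)
  qed
qed

text \<open>Grouping by the value \<open>u\<close> of the square weights \<open>g u\<close> by its
  number of square roots, \<open>1 + qchar u\<close>. This converts quadratic exponential sums into
  character sums.\<close>

lemma sum_over_squares:
  fixes g :: "'a \<Rightarrow> 'b::comm_ring_1"
  shows "(\<Sum>t\<in>UNIV. g (t\<^sup>2)) = (\<Sum>u\<in>UNIV. (1 + of_int (qchar u)) * g u)"
proof -
  have "(\<Sum>t\<in>UNIV. g (t\<^sup>2)) = (\<Sum>u\<in>UNIV. \<Sum>t\<in>{t \<in> UNIV. t\<^sup>2 = u}. g (t\<^sup>2))"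
    by (rule sum.group[symmetric]) auto
  also have "\<dots> = (\<Sum>u\<in>UNIV. of_nat (card {t. t\<^sup>2 = u}) * g u)"
    by simp
  also have "\<dots> = (\<Sum>u\<in>UNIV. (1 + of_int (qchar u)) * g u)"
  proof (intro sum.cong refl)
    fix u :: 'a
    have "of_nat (card {t. t\<^sup>2 = u}) = (of_int (int (card {t. t\<^sup>2 = u})) :: 'b)" by simp
    then show "of_nat (card {t. t\<^sup>2 = u}) * g u = (1 + of_int (qchar u)) * g u"
      unfolding card_square_roots by simp
  qed
  finally show ?thesis .
qed

text \<open>For constant \<open>g = 1\<close> the substitution formula reads
  \<open>q = q + (sum of qchar)\<close>.\<close>

lemma sum_qchar: "(\<Sum>u\<in>(UNIV::'a set). qchar u) = 0"
  using sum_over_squares[of "\<lambda>_. 1::int"] by (simp add: sum.distrib)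

text \<open>The vanishing character sum balances nonzero squares against nonsquares, and 0 is the
  only remaining element.\<close>

lemma card_qchar_eq:
  "card {x::'a. qchar x = 1} = card {x::'a. qchar x = -1}"
  "CARD('a) = 2 * card {x::'a. qchar x = 1} + 1"
proof -
  let ?P = "{x::'a. qchar x = 1}" and ?N = "{x::'a. qchar x = -1}"
  have U: "(UNIV::'a set) = insert 0 (?P \<union> ?N)" by (auto simp: qchar_def)
  have 0: "0 \<notin> ?P \<union> ?N" by (simp add: qchar_def)
  have D: "?P \<inter> ?N = {}" by auto
  have "0 = (\<Sum>u\<in>insert 0 (?P \<union> ?N). qchar u)"
    using sum_qchar U by simp
  also have "\<dots> = (\<Sum>u\<in>?P \<union> ?N. qchar u)"
    using 0 by (subst sum.insert) (auto simp: qchar_def)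
  also have "\<dots> = int (card ?P) - int (card ?N)"
    using D by (subst sum.union_disjoint) auto
  finally show *: "card ?P = card ?N" by simp
  have "card (UNIV::'a set) = Suc (card (?P \<union> ?N))"
    using U 0 by (metis card_insert_disjoint finite)
  also have "card (?P \<union> ?N) = card ?P + card ?N"
    using D by (intro card_Un_disjoint) auto
  finally show "CARD('a) = 2 * card ?P + 1" using * by simp
qed

lemma qchar_eq_1_iff: "qchar (x::'a) = 1 \<longleftrightarrow> x \<noteq> 0 \<and> (\<exists>b. b\<^sup>2 = x)"
  by (auto simp: qchar_def)

lemma qchar_square_mult:
  assumes "b \<noteq> (0::'a)" shows "qchar (b\<^sup>2 * x) = qchar x"
proof -
  have "(\<exists>c. c\<^sup>2 = b\<^sup>2 * x) \<longleftrightarrow> (\<exists>c. c\<^sup>2 = x)"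
  proof
    assume "\<exists>c. c\<^sup>2 = b\<^sup>2 * x"
    then obtain c where "c\<^sup>2 = b\<^sup>2 * x" ..
    then have "(c / b)\<^sup>2 = x" using assms by (simp add: power_divide)
    then show "\<exists>c. c\<^sup>2 = x" ..
  qed (metis power_mult_distrib)
  then show ?thesis using assms by (simp add: qchar_def)
qed

text \<open>Multiplication by a nonsquare maps the squares injectively into the equally many
  nonsquares, hence onto them.\<close>
lemma qchar_mult: "qchar (x * y :: 'a) = qchar x * qchar y"
proof -
  have sq: "qchar (x * y) = qchar x * qchar y" if x: "qchar x = 1" for x y :: 'a
  proof -
    obtain b where "b\<^sup>2 = x" "x \<noteq> 0" using x unfolding qchar_eq_1_iff by blast
    then have "qchar (x * y) = qchar y" using qchar_square_mult[of b y] by auto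
    then show ?thesis using x by simp
  qed
  have ns: "qchar (x * y) = 1" if x: "qchar x = -1" and y: "qchar y = -1" for x y :: 'a
  proof -
    have x0: "x \<noteq> 0" using x by (auto simp: qchar_def)
    let ?P = "{x::'a. qchar x = 1}" and ?N = "{x::'a. qchar x = -1}"
    have "(*) x ` ?P \<subseteq> ?N" using x sq by (auto simp: mult.commute[of x])
    moreover have "card ((*) x ` ?P) = card ?P"
      using x0 by (intro card_image inj_onI) simp
    ultimately have "(*) x ` ?P = ?N"
      using card_qchar_eq(1) by (intro card_subset_eq) auto
    then obtain z where z: "qchar z = 1" "y = x * z" using y by blast
    have "x * y = x\<^sup>2 * z" using z by (simp add: power2_eq_square)
    then show ?thesis using qchar_square_mult[OF x0, of z] z(1) by simp
  qed
  consider "x = 0" | "y = 0" | "qchar x = 1" | "qchar y = 1" | "qchar x = -1" "qchar y = -1"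
    by (metis qchar_def)
  then show ?thesis
  proof cases
    case 3 then show ?thesis by (rule sq)
  next
    case 4 then show ?thesis using sq[of y x] by (simp add: mult.commute)
  next
    case 5 then show ?thesis using ns by simp
  qed (simp_all add: qchar_def)
qed

lemma qchar_inverse: "qchar (inverse x :: 'a) = qchar x"
proof (cases "x = 0")
  case False
  then have "inverse x = (inverse x)\<^sup>2 * x" by (simp add: power2_eq_square)
  then show ?thesis using qchar_square_mult[of "inverse x" x] False by simp
qed simp

text \<open>The involution \<open>x \<mapsto> 1/x\<close> on the nonzero squares has the fixed points \<open>1\<close> and,
  if it is a square, \<open>-1\<close>; this gives the parity of the number of squares.\<close>
lemma qchar_minus_1: "qchar (-1 :: 'a) = (if CARD('a) mod 4 = 1 then 1 else -1)"
proof -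
  let ?P = "{x::'a. qchar x = 1}"
  have "even (card (?P - {1, -1}))"
  proof (rule even_card_involution[of _ inverse])
    fix x assume x: "x \<in> ?P - {1, - 1}"
    then have x0: "x \<noteq> 0" by (auto simp: qchar_def)
    show "inverse x \<in> ?P - {1, -1}"
      using x qchar_inverse[of x] inverse_eq_iff_eq[of x "-1"] by auto
    show "inverse x \<noteq> x"
    proof
      assume "inverse x = x"
      then have "x\<^sup>2 = 1" using x0 by (metis power2_eq_square right_inverse)
      then show False using x by (auto simp: power2_eq_1_iff)
    qed
  qed auto
  moreover have one: "1 \<in> ?P" by simp
  moreover have "(1::'a) \<noteq> -1" using minus_neq_self[of 1] by auto
  ultimately have "even (card ?P) \<longleftrightarrow> qchar (-1::'a) = 1"
  proof -
    \<comment> \<open>Removing \<open>-1\<close> lowers the cardinality exactly when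
      \<open>-1\<close> is a square, so the parity of \<open>card ?P\<close> detects
      \<open>qchar (-1)\<close>.\<close>
    have "?P - {1, -1} = ?P - {1} - {-1}" by auto
    then have "card (?P - {1, -1}) = (if qchar (-1::'a) = 1 then card (?P - {1}) - 1 else card (?P - {1}))"
      using \<open>(1::'a) \<noteq> -1\<close> by (auto simp: card_Diff_singleton)
    moreover have "card ?P = Suc (card (?P - {1}))"
      using one by (intro card.remove) auto
    moreover have "card (?P - {1}) > 0" if "qchar (-1::'a) = 1"
    proof -
      have "-1 \<in> ?P - {1}" using that \<open>(1::'a) \<noteq> -1\<close> by auto
      then show ?thesis by (metis card_gt_0_iff empty_iff finite)
    qed
    ultimately show ?thesis
      using \<open>even (card (?P - {1, -1}))\<close> by (cases "qchar (-1::'a) = 1") (simp_all only: if_True if_False, presburger+)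
  qed
  moreover have "CARD('a) mod 4 = 1 \<longleftrightarrow> even (card ?P)"
    using card_qchar_eq(2) by presburger
  moreover have "qchar (-1::'a) = 1 \<or> qchar (-1::'a) = -1"
    by (auto simp: qchar_def)
  ultimately show ?thesis by auto
qed

end

section \<open>A nontrivial additive character\<close>

definition additive_subgroup :: "'a::ab_group_add set \<Rightarrow> bool" where
  "additive_subgroup H \<longleftrightarrow> 0 \<in> H \<and> (\<forall>x\<in>H. \<forall>y\<in>H. x - y \<in> H)"

lemma additive_subgroup_minus: "additive_subgroup H \<Longrightarrow> x \<in> H \<Longrightarrow> - x \<in> H"
  by (metis additive_subgroup_def diff_0)

lemma additive_subgroup_add: "additive_subgroup H \<Longrightarrow> x \<in> H \<Longrightarrow> y \<in> H \<Longrightarrow> x + y \<in> H"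
  by (metis additive_subgroup_def additive_subgroup_minus diff_minus_eq_add)

lemma additive_subgroup_of_int_mult:
  fixes x :: "'a::ring_1"
  assumes "additive_subgroup H" "x \<in> H"
  shows "of_int k * x \<in> H"
proof -
  have nat: "of_nat n * x \<in> H" for n
    by (induction n) (use assms additive_subgroup_add in \<open>auto simp: distrib_right additive_subgroup_def\<close>)
  show ?thesis
  proof (cases k rule: int_cases2)
    case (nonneg n)
    then show ?thesis using nat[of n] by simp
  next
    case (nonpos n)
    then show ?thesis using additive_subgroup_minus[OF assms(1) nat[of n]] by simp
  qed
qed

text \<open>A maximal additive subgroup \<open>H\<close> avoiding \<open>1\<close> is a complement of the prime field;
  the character is trivial on \<open>H\<close> and maps \<open>1\<close> to a primitive \<open>p\<close>-th root of unity.\<close>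
lemma nontrivial_additive_character_exists:
  obtains e :: "'a::{finite,field} \<Rightarrow> complex"
  where "\<And>x y. e (x + y) = e x * e y" "\<And>x. norm (e x) = 1" "e 1 \<noteq> 1"
proof -
  define p where "p = CHAR('a)"
  have p: "prime p" unfolding p_def
    by (intro prime_CHAR_semidom finite_imp_CHAR_pos finite)
  have of_int_0: "(of_int k :: 'a) = 0 \<longleftrightarrow> int p dvd k" for k
    unfolding p_def by (rule of_int_eq_0_iff_char_dvd)
  define \<H> where "\<H> = {H :: 'a set. additive_subgroup H \<and> 1 \<notin> H}"
  have "{0} \<in> \<H>" by (simp add: \<H>_def additive_subgroup_def)
  then obtain H where H: "H \<in> \<H>" and max: "\<And>H'. H' \<in> \<H> \<Longrightarrow> H \<subseteq> H' \<Longrightarrow> H' = H"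
    using finite_has_maximal[of \<H>] by (metis empty_iff finite)
  have sub: "additive_subgroup H" and 1: "1 \<notin> H" using H by (auto simp: \<H>_def)
  \<comment> \<open>\<open>H\<close> meets the prime field only in 0: for \<open>k\<close> prime to
    \<open>p\<close>, a Bezout relation writes 1 as an integer multiple of \<open>of_int k\<close>,
    which would put 1 into \<open>H\<close>.\<close>
  have of_int_H: "of_int k \<in> H \<longleftrightarrow> int p dvd k" for k
  proof
    assume k: "of_int k \<in> H"
    show "int p dvd k"
    proof (rule ccontr)
      assume "\<not> int p dvd k"
      then have "coprime (int p) k" using p by (simp add: prime_imp_coprime)
      then obtain u v where "u * int p + v * k = 1" using bezout_int[of "int p" k] by (auto simp: coprime_iff_gcd_eq_1)
      then have "(of_int (u * int p + v * k) :: 'a) = 1" by simp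
      then have "(1::'a) = of_int v * of_int k" using of_int_0[of "int p"] by simp
      then show False using additive_subgroup_of_int_mult[OF sub k, of v] 1 by simp
    qed
  next
    assume "int p dvd k"
    then show "of_int k \<in> H" using of_int_0[of k] sub by (simp add: additive_subgroup_def)
  qed
  \<comment> \<open>\<open>H\<close> and the prime field together span everything: for
    \<open>x\<close> outside \<open>H\<close>, maximality puts 1 into the subgroup generated by
    \<open>H\<close> and \<open>x\<close>. The coefficient of \<open>x\<close> there is invertible
    modulo \<open>p\<close>, so the relation can be solved for \<open>x\<close>.\<close>
  have "\<exists>k. x - of_int k \<in> H" for x :: 'a
  proof (cases "x \<in> H")
    case True
    then show ?thesis by (intro exI[of _ 0]) simp
  next
    case False
    define H' where "H' = {h + of_int k * x | h k. h \<in> H}"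
    have sub': "additive_subgroup H'"
      unfolding additive_subgroup_def
    proof (intro conjI ballI)
      show "0 \<in> H'" using sub unfolding H'_def additive_subgroup_def
        by (auto intro!: exI[of _ 0])
      fix a b assume "a \<in> H'" "b \<in> H'"
      then obtain h k h' k' where *: "a = h + of_int k * x" "b = h' + of_int k' * x" "h \<in> H" "h' \<in> H"
        unfolding H'_def by blast
      then have "a - b = (h - h') + of_int (k - k') * x" by (simp add: algebra_simps)
      moreover have "h - h' \<in> H" using * sub by (simp add: additive_subgroup_def)
      ultimately show "a - b \<in> H'" unfolding H'_def by blast
    qed
    have "h \<in> H'" if "h \<in> H" for h
      unfolding H'_def using that by (intro CollectI exI[of _ h] exI[of _ 0]) simp
    then have "H \<subseteq> H'" by blast
    moreover have "x \<in> H'" unfolding H'_def using sub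
      by (intro CollectI exI[of _ 0] exI[of _ 1]) (simp add: additive_subgroup_def)
    ultimately have "1 \<in> H'" using max[of H'] sub' False unfolding \<H>_def by blast
    then obtain h k where hk: "1 = h + of_int k * x" "h \<in> H" unfolding H'_def by blast
    have "\<not> int p dvd k"
    proof
      assume "int p dvd k"
      then have "(of_int k :: 'a) = 0" using of_int_0 by simp
      then show False using hk 1 by simp
    qed
    then have "coprime (int p) k" using p by (simp add: prime_imp_coprime)
    then obtain u v where "u * int p + v * k = 1" using bezout_int[of "int p" k] by (auto simp: coprime_iff_gcd_eq_1)
    then have "(of_int (u * int p + v * k) :: 'a) = 1" by simp
    then have vk: "of_int v * of_int k = (1::'a)" using of_int_0[of "int p"] by simp
    have "of_int v = of_int v * h + (of_int v * of_int k) * x"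
      using hk by (metis distrib_left mult.assoc mult.right_neutral)
    then have "x - of_int v = of_int (- v) * h" using vk by (simp add: algebra_simps)
    then show ?thesis using additive_subgroup_of_int_mult[OF sub hk(2), of "- v"] by metis
  qed
  then obtain k where k: "\<And>x. x - of_int (k x) \<in> H" by metis
  \<comment> \<open>The chosen integers \<open>k x\<close> are additive only modulo
    \<open>p\<close>, which suffices since \<open>cis (2 * pi * i / p)\<close> depends only on the
    residue of \<open>i\<close>.\<close>
  define e where "e = (\<lambda>x. cis (2 * pi * of_int (k x) / p))"
  have p0: "real p > 0" using p prime_gt_0_nat by simp
  have cong: "cis (2 * pi * of_int i / p) = cis (2 * pi * of_int j / p)" if dvd: "int p dvd i - j" for i j
  proof -
    obtain c where "i - j = int p * c" using dvd by (elim dvdE)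
    then have "real_of_int (i - j) = of_int (int p * c)" by simp
    then have "real_of_int i = of_int j + p * of_int c" by simp
    then have "2 * pi * of_int i / p = 2 * pi * of_int j / p + 2 * pi * of_int c"
      using p0 by (simp add: field_simps)
    then show ?thesis using cis_multiple_2pi[of "of_int c"] by (metis Ints_of_int cis_mult mult.right_neutral)
  qed
  show ?thesis
  proof
    fix x y
    have "(x - of_int (k x)) + (y - of_int (k y)) \<in> H"
      by (intro additive_subgroup_add sub k)
    then have "(x - of_int (k x)) + (y - of_int (k y)) - (x + y - of_int (k (x + y))) \<in> H"
      using sub k unfolding additive_subgroup_def by blast
    also have "(x - of_int (k x)) + (y - of_int (k y)) - (x + y - of_int (k (x + y)))
        = of_int (k (x + y) - (k x + k y))" by simp
    finally have "of_int (k (x + y) - (k x + k y)) \<in> H" .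
    then have "e (x + y) = cis (2 * pi * of_int (k x + k y) / p)"
      unfolding e_def of_int_H by (rule cong)
    also have "\<dots> = e x * e y" by (simp add: e_def cis_mult add_divide_distrib distrib_left)
    finally show "e (x + y) = e x * e y" .
  next
    show "norm (e x) = 1" for x by (simp add: e_def)
  next
    have "of_int (k 1 - 1) \<in> H" using additive_subgroup_minus[OF sub k[of 1]] by simp
    then have "e 1 = cis (2 * pi * of_int 1 / p)" unfolding e_def of_int_H by (rule cong)
    moreover have "cis (2 * pi * of_int 1 / p) \<noteq> 1"
    proof
      assume "cis (2 * pi * of_int 1 / p) = 1"
      then have "cos (2 * pi / p) = 1" by (simp add: complex_eq_iff)
      then obtain n :: int where "2 * pi / p = of_int n * 2 * pi" using cos_one_2pi_int by auto
      then have "1 = real_of_int (n * int p)" using p0 by (simp add: field_simps)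
      then have "n * int p = 1" by linarith
      then have "int p dvd 1" by (metis dvd_triv_right)
      then show False using prime_gt_1_nat[OF p] by simp
    qed
    ultimately show "e 1 \<noteq> 1" by simp
  qed
qed

section \<open>Gauss sums and Fourier transforms of quadratic forms\<close>

definition sqnorm :: "'a::comm_semiring_1 ^ 'n \<Rightarrow> 'a" where
  "sqnorm m = (\<Sum>i\<in>UNIV. (m $ i)\<^sup>2)"

definition dot :: "'a::comm_semiring_1 ^ 'n \<Rightarrow> 'a ^ 'n \<Rightarrow> 'a" where
  "dot m z = (\<Sum>i\<in>UNIV. m $ i * z $ i)"

lemma sqnorm_0 [simp]: "sqnorm 0 = 0"
  by (simp add: sqnorm_def)

lemma fdist_eq_sqnorm: "fdist x y = sqnorm (x - y)"
  by (simp add: fdist_def sqnorm_def)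

lemma dot_0_left [simp]: "dot 0 z = 0"
  by (simp add: dot_def)

lemma dot_diff_right: "dot m (x - y) = dot m x - dot m (y :: 'a::comm_ring_1 ^ 'n)"
  by (simp add: dot_def right_diff_distrib sum_subtractf)

text \<open>Distributivity, with vectors read as functions on the index type. It factors exponential
  sums over \<open>F_q^d\<close> into one-dimensional ones.\<close>

lemma sum_prod_vec:
  fixes f :: "'n::finite \<Rightarrow> 'a::finite \<Rightarrow> 'b::comm_semiring_1"
  shows "(\<Sum>m\<in>(UNIV :: ('a ^ 'n) set). \<Prod>i\<in>UNIV. f i (m $ i)) = (\<Prod>i\<in>UNIV. \<Sum>t\<in>UNIV. f i t)"
proof -
  have "(\<Prod>i\<in>UNIV. \<Sum>t\<in>UNIV. f i t) = (\<Sum>g\<in>PiE UNIV (\<lambda>_. UNIV). \<Prod>i\<in>UNIV. f i (g i))"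
    by (rule prod_sum_PiE) auto
  also have "\<dots> = (\<Sum>m\<in>(UNIV :: ('a ^ 'n) set). \<Prod>i\<in>UNIV. f i (m $ i))"
    by (rule sum.reindex_bij_witness[of _ vec_nth vec_lambda]) auto
  finally show ?thesis ..
qed

text \<open>The Ramanujan sum of a finite field: the sum of \<open>e (u * t)\<close> over \<open>u \<noteq> 0\<close>.\<close>
definition ramanujan :: "'a::{finite,field} \<Rightarrow> real" where
  "ramanujan t = (if t = 0 then real CARD('a) else 0) - 1"

locale additive_character =
  fixes e :: "'a::{finite,field} \<Rightarrow> complex"
  assumes e_add: "e (x + y) = e x * e y"
    and norm_e: "norm (e x) = 1"
    and e_1: "e 1 \<noteq> 1"
    and two: "(2::'a) \<noteq> 0"
begin

abbreviation \<eta> :: "'a \<Rightarrow> complex" where "\<eta> t \<equiv> of_int (qchar t)"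

definition gauss :: complex where "gauss = (\<Sum>u\<in>UNIV. \<eta> u * e u)"

lemma e_nonzero: "e x \<noteq> 0"
  using norm_e[of x] by auto

lemma e_0 [simp]: "e 0 = 1"
  using e_add[of 0 0] e_nonzero[of 0] by simp

lemma e_minus: "e (- x) = cnj (e x)"
proof -
  have "e x * e (- x) = 1" using e_add[of x "- x"] by simp
  moreover have "e x * cnj (e x) = 1" using complex_norm_square[of "e x"] norm_e[of x] by simp
  ultimately show ?thesis using e_nonzero[of x] by (metis mult_left_cancel)
qed

lemma e_sum: "e (\<Sum>i\<in>I. f i) = (\<Prod>i\<in>I. e (f i))"
  by (induction I rule: infinite_finite_induct) (auto simp: e_add)

lemma chi_mult: "\<eta> (x * y) = \<eta> x * \<eta> y"
  by (simp add: qchar_mult[OF two])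

lemma chi_square: "x \<noteq> 0 \<Longrightarrow> \<eta> x * \<eta> x = 1"
  by (simp add: qchar_def)

text \<open>For \<open>a \<noteq> 0\<close> rescaling reduces to the sum of all \<open>e x\<close>;
  translation by 1 preserves that sum but multiplies it by \<open>e 1 \<noteq> 1\<close>, so it is
  0.\<close>

lemma sum_e: "(\<Sum>x\<in>UNIV. e (a * x)) = (if a = 0 then of_nat CARD('a) else 0)"
proof (cases "a = 0")
  case False
  have "(\<Sum>x\<in>UNIV. e (a * x)) = (\<Sum>x\<in>UNIV. e x)"
    using False by (intro sum.reindex_bij_witness[of _ "\<lambda>x. x / a" "\<lambda>x. a * x"]) auto
  moreover have "(\<Sum>x\<in>UNIV. e x) = 0"
  proof -
    have "(\<Sum>x\<in>UNIV. e x) = (\<Sum>x\<in>UNIV. e (x + 1))"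
      by (intro sum.reindex_bij_witness[of _ "\<lambda>x. x + 1" "\<lambda>x. x - 1"]) auto
    also have "\<dots> = (\<Sum>x\<in>UNIV. e x) * e 1"
      by (simp add: e_add sum_distrib_right)
    finally show ?thesis using e_1 by simp
  qed
  ultimately show ?thesis using False by simp
qed simp

lemma sum_e_nonzero: "(\<Sum>u\<in>UNIV - {0}. e (u * t)) = of_real (ramanujan t)"
proof -
  have "(\<Sum>u\<in>UNIV. e (t * u)) = e (t * 0) + (\<Sum>u\<in>UNIV - {0}. e (t * u))"
    by (rule sum.remove) auto
  also have "(\<Sum>u\<in>UNIV. e (t * u)) = of_real (ramanujan t) + 1"
    by (simp add: sum_e ramanujan_def)
  finally show ?thesis by (simp add: mult.commute[of t])
qed

text \<open>For \<open>t \<noteq> 0\<close> substitute \<open>v = t * u\<close> and use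
  \<open>\<eta> t * \<eta> t = 1\<close>; at \<open>t = 0\<close> both sides vanish.\<close>

lemma sum_chi_e: "(\<Sum>u\<in>UNIV. \<eta> u * e (t * u)) = \<eta> t * gauss"
proof (cases "t = 0")
  case True
  have "(\<Sum>u\<in>UNIV. \<eta> u) = of_int (\<Sum>u\<in>(UNIV::'a set). qchar u)" by simp
  then show ?thesis using True sum_qchar[OF two] by simp
next
  case False
  have "(\<Sum>u\<in>UNIV. \<eta> u * e (t * u)) = (\<Sum>v\<in>UNIV. \<eta> t * (\<eta> v * e v))"
  proof (rule sum.reindex_bij_witness[of _ "\<lambda>x. x / t" "\<lambda>x. t * x"])
    fix u
    show "\<eta> t * (\<eta> (t * u) * e (t * u)) = \<eta> u * e (t * u)"
      using chi_square[OF False] by (simp add: chi_mult flip: mult.assoc)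
  qed (use False in auto)
  then show ?thesis by (simp add: gauss_def sum_distrib_left)
qed

text \<open>In the root-counting weight \<open>1 + \<eta> u\<close> the constant part sums to 0 by
  orthogonality, leaving the character sum.\<close>

lemma quadratic_gauss_sum:
  assumes "s \<noteq> 0" shows "(\<Sum>t\<in>UNIV. e (s * t\<^sup>2)) = \<eta> s * gauss"
proof -
  have "(\<Sum>t\<in>UNIV. e (s * t\<^sup>2)) = (\<Sum>u\<in>UNIV. e (s * u)) + (\<Sum>u\<in>UNIV. \<eta> u * e (s * u))"
    using sum_over_squares[OF two, of "\<lambda>u. e (s * u)"] by (simp add: distrib_right sum.distrib)
  then show ?thesis using assms by (simp add: sum_e sum_chi_e)
qed

text \<open>The quadratic sums for \<open>s = 1\<close> and \<open>s = -1\<close> multiply to a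
  double sum of \<open>e (t\<^sup>2 - u\<^sup>2)\<close>. With \<open>v = t - u\<close> the exponent
  is \<open>v\<^sup>2 + 2 * v * u\<close>, linear in \<open>u\<close>, so only \<open>v = 0\<close>
  survives.\<close>

lemma gauss_square: "gauss\<^sup>2 = \<eta> (-1) * of_nat CARD('a)"
proof -
  have "gauss * (\<eta> (-1) * gauss) = (\<Sum>t\<in>UNIV. e (1 * t\<^sup>2)) * (\<Sum>u\<in>UNIV. e (-1 * u\<^sup>2))"
    using quadratic_gauss_sum[of 1] quadratic_gauss_sum[of "-1"]
    by simp
  also have "\<dots> = (\<Sum>u\<in>UNIV. \<Sum>t\<in>UNIV. e (t\<^sup>2 - u\<^sup>2))"
    by (subst sum.swap) (simp add: sum_product flip: e_add)
  also have "\<dots> = (\<Sum>u\<in>UNIV. \<Sum>v\<in>UNIV. e (v\<^sup>2) * e (2 * v * u))"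
  proof (rule sum.cong[OF refl])
    fix u
    show "(\<Sum>t\<in>UNIV. e (t\<^sup>2 - u\<^sup>2)) = (\<Sum>v\<in>UNIV. e (v\<^sup>2) * e (2 * v * u))"
      by (rule sum.reindex_bij_witness[of _ "\<lambda>v. v + u" "\<lambda>t. t - u"])
        (auto simp: power2_eq_square algebra_simps simp flip: e_add)
  qed
  also have "\<dots> = (\<Sum>v\<in>UNIV. e (v\<^sup>2) * (\<Sum>u\<in>UNIV. e (2 * v * u)))"
    by (subst sum.swap) (simp add: sum_distrib_left)
  also have "\<dots> = (\<Sum>v\<in>(UNIV :: 'a set). if v = 0 then of_nat CARD('a) else 0)"
    by (intro sum.cong refl) (use two in \<open>auto simp: sum_e\<close>)
  also have "\<dots> = of_nat CARD('a)" by simp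
  finally have "\<eta> (-1) * gauss\<^sup>2 = of_nat CARD('a)"
    by (simp add: power2_eq_square mult_ac)
  then have "\<eta> (-1) * \<eta> (-1) * gauss\<^sup>2 = \<eta> (-1) * of_nat CARD('a)"
    by (simp add: mult.assoc)
  then show ?thesis using chi_square[of "-1"] by simp
qed

lemma gauss_nonzero: "gauss \<noteq> 0"
proof -
  have "\<eta> (-1) \<noteq> 0" by (simp add: qchar_def)
  then show ?thesis using gauss_square by auto
qed

text \<open>Complete the square by shifting \<open>t\<close> by \<open>z / (2 * s)\<close>.\<close>

lemma quadratic_linear_sum:
  assumes "s \<noteq> 0"
  shows "(\<Sum>t\<in>UNIV. e (s * t\<^sup>2 + t * z)) = \<eta> s * gauss * e (- z\<^sup>2 / (4 * s))"
proof -
  have "(\<Sum>t\<in>UNIV. e (s * t\<^sup>2 + t * z)) = (\<Sum>t\<in>UNIV. e (s * t\<^sup>2) * e (- z\<^sup>2 / (4 * s)))"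
  proof (rule sum.reindex_bij_witness[of _ "\<lambda>t. t - z / (2 * s)" "\<lambda>t. t + z / (2 * s)"])
    fix t
    define w where "w = z / (2 * s)"
    have z: "z = 2 * s * w" using assms two by (simp add: w_def)
    have "- z\<^sup>2 / (4 * s) = - s * w\<^sup>2"
      using assms four_neq_zero[OF two] by (simp add: z power2_eq_square field_simps)
    then have "s * (t + w)\<^sup>2 + - z\<^sup>2 / (4 * s) = s * t\<^sup>2 + t * z"
      by (simp add: z power2_eq_square algebra_simps)
    then show "e (s * (t + z / (2 * s))\<^sup>2) * e (- z\<^sup>2 / (4 * s)) = e (s * t\<^sup>2 + t * z)"
      unfolding w_def by (metis e_add)
  qed auto
  then show ?thesis
    using quadratic_gauss_sum[OF assms] by (simp flip: sum_distrib_right)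
qed

section \<open>Fourier transforms on \<open>F_q^d\<close>\<close>

lemma sum_e_dot:
  "(\<Sum>m\<in>UNIV. e (dot m (z :: 'a ^ 'n))) = (if z = 0 then of_nat CARD('a) ^ CARD('n) else 0)"
proof -
  have "(\<Sum>m\<in>UNIV. e (dot m z)) = (\<Prod>i\<in>UNIV. \<Sum>t\<in>UNIV. e (t * z $ i))"
    unfolding dot_def e_sum by (rule sum_prod_vec)
  also have "\<dots> = (\<Prod>i\<in>UNIV. if z $ i = 0 then of_nat CARD('a) else 0)"
    by (subst mult.commute) (simp add: sum_e)
  also have "\<dots> = (if z = 0 then of_nat CARD('a) ^ CARD('n) else 0)"
    by (auto simp: vec_eq_iff)
  finally show ?thesis .
qed

text \<open>The exponent is a sum over coordinates, so the transform is a product of one-dimensional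
  sums, each contributing a factor \<open>\<eta> s * gauss\<close>.\<close>

lemma gaussian_fourier_transform:
  fixes z :: "'a ^ 'n"
  assumes "s \<noteq> 0"
  shows "(\<Sum>m\<in>UNIV. e (s * sqnorm m) * e (dot m z)) = (\<eta> s * gauss) ^ CARD('n) * e (- sqnorm z / (4 * s))"
proof -
  have "(\<Sum>m\<in>UNIV. e (s * sqnorm m) * e (dot m z))
      = (\<Sum>m\<in>UNIV. \<Prod>i\<in>UNIV. e (s * (m $ i)\<^sup>2 + m $ i * z $ i))"
    by (simp add: sqnorm_def dot_def sum_distrib_left sum.distrib flip: e_add e_sum)
  also have "\<dots> = (\<Prod>i\<in>UNIV. \<Sum>t\<in>UNIV. e (s * t\<^sup>2 + t * z $ i))"
    by (rule sum_prod_vec)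
  also have "\<dots> = (\<eta> s * gauss) ^ CARD('n) * e (\<Sum>i\<in>UNIV. - (z $ i)\<^sup>2 / (4 * s))"
    by (simp add: quadratic_linear_sum[OF assms] prod.distrib power_mult_distrib e_sum)
  also have "(\<Sum>i\<in>UNIV. - (z $ i)\<^sup>2 / (4 * s)) = - sqnorm z / (4 * s)"
    by (simp add: sqnorm_def sum_negf sum_divide_distrib)
  finally show ?thesis .
qed

text \<open>The map \<open>u \<mapsto> - 1 / (4 * u)\<close> is an involution of the nonzero
  elements that makes the exponent linear.\<close>

lemma sum_e_reciprocal: "(\<Sum>u\<in>UNIV - {0}. e (- t / (4 * u))) = of_real (ramanujan t)"
proof -
  have "(\<Sum>u\<in>UNIV - {0}. e (- t / (4 * u))) = (\<Sum>v\<in>UNIV - {0}. e (v * t))"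
    using four_neq_zero[OF two]
    by (intro sum.reindex_bij_witness[of _ "\<lambda>v. - 1 / (4 * v)" "\<lambda>u. - 1 / (4 * u)"]) auto
  then show ?thesis by (simp add: sum_e_nonzero)
qed

text \<open>The same involution applies; since \<open>- 1 / (4 * u)\<close> is \<open>- u\<close>
  times a square, it multiplies the character by \<open>\<eta> (-1)\<close>.\<close>

lemma sum_chi_e_reciprocal:
  "(\<Sum>u\<in>UNIV - {0}. \<eta> u * e (- t / (4 * u))) = \<eta> (-1) * \<eta> t * gauss"
proof -
  have "(\<Sum>u\<in>UNIV - {0}. \<eta> u * e (- t / (4 * u))) = (\<Sum>v\<in>UNIV - {0}. \<eta> (-1) * (\<eta> v * e (t * v)))"
  proof (rule sum.reindex_bij_witness[of _ "\<lambda>v. - 1 / (4 * v)" "\<lambda>u. - 1 / (4 * u)"])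
    fix u :: 'a assume u: "u \<in> UNIV - {0}"
    have "- 1 / (4 * u) = (1 / (2 * u))\<^sup>2 * (- 1 * u)"
      using u two four_neq_zero[OF two] by (simp add: power2_eq_square field_simps)
    then have "qchar (- 1 / (4 * u)) = qchar (- 1 * u)"
      using u two qchar_square_mult[OF two, of "1 / (2 * u)" "- 1 * u"] by simp
    then have "\<eta> (-1) * \<eta> (- 1 / (4 * u)) = \<eta> (-1) * \<eta> (-1) * \<eta> u"
      using chi_mult[of "-1" u] by simp
    then have "\<eta> (-1) * \<eta> (- 1 / (4 * u)) = \<eta> u" using chi_square[of "-1"] by simp
    then show "\<eta> (-1) * (\<eta> (- 1 / (4 * u)) * e (t * (- 1 / (4 * u)))) = \<eta> u * e (- t / (4 * u))"
      by (simp flip: mult.assoc)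
  qed (use four_neq_zero[OF two] in auto)
  also have "\<dots> = \<eta> (-1) * (\<Sum>v\<in>UNIV. \<eta> v * e (t * v))"
    by (subst sum.remove[of UNIV 0]) (auto simp: sum_distrib_left qchar_def)
  finally show ?thesis by (simp add: sum_chi_e)
qed

text \<open>The Ramanujan sum is a superposition of \<open>e (u * sqnorm m)\<close> over
  \<open>u \<noteq> 0\<close>, each of which has a known transform.\<close>

lemma ramanujan_transform:
  fixes z :: "'a ^ 'n"
  shows "(\<Sum>m\<in>UNIV. of_real (ramanujan (sqnorm m)) * e (dot m z))
    = (\<Sum>u\<in>UNIV - {0}. \<eta> u ^ CARD('n) * e (- sqnorm z / (4 * u))) * gauss ^ CARD('n)"
proof -
  have "(\<Sum>m\<in>UNIV. of_real (ramanujan (sqnorm m)) * e (dot m z))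
      = (\<Sum>u\<in>UNIV - {0}. \<Sum>m\<in>UNIV. e (u * sqnorm m) * e (dot m z))"
    by (subst sum.swap) (simp flip: sum_e_nonzero sum_distrib_right)
  also have "\<dots> = (\<Sum>u\<in>UNIV - {0}. (\<eta> u * gauss) ^ CARD('n) * e (- sqnorm z / (4 * u)))"
    by (intro sum.cong refl gaussian_fourier_transform) auto
  finally show ?thesis by (simp add: power_mult_distrib sum_distrib_left sum_distrib_right mult_ac)
qed

text \<open>The factor \<open>gauss\<close> allows \<open>\<eta> (sqnorm m) * gauss\<close> to be
  expanded as a sum of \<open>\<eta> u * e (u * sqnorm m)\<close>; the extra \<open>\<eta> u\<close>
  accounts for the exponent \<open>Suc CARD('n)\<close>.\<close>

lemma chi_transform:
  fixes z :: "'a ^ 'n"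
  shows "gauss * (\<Sum>m\<in>UNIV. \<eta> (sqnorm m) * e (dot m z))
    = (\<Sum>u\<in>UNIV - {0}. \<eta> u ^ Suc CARD('n) * e (- sqnorm z / (4 * u))) * gauss ^ CARD('n)"
proof -
  have "gauss * (\<Sum>m\<in>UNIV. \<eta> (sqnorm m) * e (dot m z))
      = (\<Sum>m\<in>UNIV. (\<eta> (sqnorm m) * gauss) * e (dot m z))"
    by (simp add: sum_distrib_left mult_ac)
  also have "\<dots> = (\<Sum>u\<in>UNIV. \<eta> u * (\<Sum>m\<in>UNIV. e (u * sqnorm m) * e (dot m z)))"
    unfolding sum_chi_e[symmetric] sum_distrib_right sum_distrib_left
    by (subst sum.swap) (simp add: mult_ac)
  also have "\<dots> = (\<Sum>u\<in>UNIV - {0}. \<eta> u * (\<Sum>m\<in>UNIV. e (u * sqnorm m) * e (dot m z)))"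
    by (subst sum.remove[of UNIV 0]) (auto simp: qchar_def)
  also have "\<dots> = (\<Sum>u\<in>UNIV - {0}. \<eta> u * ((\<eta> u * gauss) ^ CARD('n) * e (- sqnorm z / (4 * u))))"
    by (intro sum.cong refl arg_cong2[of _ _ _ _ "(*)"] gaussian_fourier_transform) auto
  finally show ?thesis by (simp add: power_mult_distrib sum_distrib_left sum_distrib_right mult_ac)
qed

lemma chi_power:
  assumes "u \<noteq> 0" shows "\<eta> u ^ n = (if even n then 1 else \<eta> u)"
  using assms by (auto simp: qchar_def)

text \<open>For odd \<open>d\<close> the power of \<open>\<eta> u\<close> is \<open>\<eta> u\<close>
  in the Ramanujan transform and 1 in the character transform, so the transform exchanges the two
  functions up to scalars.\<close>

lemma transforms_odd:
  fixes z :: "'a ^ 'n"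
  assumes d: "CARD('n) = 2 * k + 1"
  shows "(\<Sum>m\<in>UNIV. of_real (ramanujan (sqnorm m)) * e (dot m z))
      = \<eta> (-1) ^ k * of_nat CARD('a) ^ (k + 1) * \<eta> (sqnorm z)" (is ?R)
    and "(\<Sum>m\<in>UNIV. \<eta> (sqnorm m) * e (dot m z))
      = \<eta> (-1) ^ k * of_nat CARD('a) ^ k * of_real (ramanujan (sqnorm z))" (is ?C)
proof -
  have g: "gauss ^ (2 * k + 2) = \<eta> (-1) ^ (k + 1) * of_nat CARD('a) ^ (k + 1)"
    "gauss ^ (2 * k) = \<eta> (-1) ^ k * of_nat CARD('a) ^ k"
    using gauss_square power_mult[of gauss 2 "k + 1"]
    by (simp_all only: power_mult power_mult_distrib distrib_left mult_1_right)
  have "(\<Sum>m\<in>UNIV. of_real (ramanujan (sqnorm m)) * e (dot m z))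
      = (\<Sum>u\<in>UNIV - {0}. \<eta> u * e (- sqnorm z / (4 * u))) * gauss ^ CARD('n)"
    unfolding ramanujan_transform by (simp add: chi_power d)
  also have "\<dots> = \<eta> (-1) * \<eta> (sqnorm z) * gauss ^ (2 * k + 2)"
    unfolding sum_chi_e_reciprocal d by simp
  \<comment> \<open>The reciprocal sum gives one sign and the Gauss power \<open>k + 1\<close> more;
    two of them cancel.\<close>
  also have "\<dots> = (\<eta> (-1) * \<eta> (-1)) * (\<eta> (-1) ^ k * of_nat CARD('a) ^ (k + 1) * \<eta> (sqnorm z))"
    unfolding g by (simp add: mult_ac)
  finally show ?R using chi_square[of "-1"] by simp
  have "gauss * (\<Sum>m\<in>UNIV. \<eta> (sqnorm m) * e (dot m z))
      = (\<Sum>u\<in>UNIV - {0}. e (- sqnorm z / (4 * u))) * gauss ^ CARD('n)"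
    unfolding chi_transform by (simp add: chi_power d del: power_Suc)
  also have "\<dots> = gauss * (of_real (ramanujan (sqnorm z)) * gauss ^ (2 * k))"
    unfolding sum_e_reciprocal d by simp
  finally show ?C using gauss_nonzero unfolding g by (simp add: mult_ac)
qed

text \<open>For even \<open>d\<close> the parities are reversed, and each of the two functions is
  mapped to a multiple of itself.\<close>

lemma transforms_even:
  fixes z :: "'a ^ 'n"
  assumes d: "CARD('n) = 2 * k"
  shows "(\<Sum>m\<in>UNIV. of_real (ramanujan (sqnorm m)) * e (dot m z))
      = \<eta> (-1) ^ k * of_nat CARD('a) ^ k * of_real (ramanujan (sqnorm z))" (is ?R)
    and "(\<Sum>m\<in>UNIV. \<eta> (sqnorm m) * e (dot m z))
      = \<eta> (-1) ^ (k + 1) * of_nat CARD('a) ^ k * \<eta> (sqnorm z)" (is ?C)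
proof -
  have g: "gauss ^ (2 * k) = \<eta> (-1) ^ k * of_nat CARD('a) ^ k"
    using gauss_square by (simp add: power_mult power_mult_distrib)
  have "(\<Sum>m\<in>UNIV. of_real (ramanujan (sqnorm m)) * e (dot m z))
      = (\<Sum>u\<in>UNIV - {0}. e (- sqnorm z / (4 * u))) * gauss ^ CARD('n)"
    unfolding ramanujan_transform by (simp add: chi_power d)
  then show ?R unfolding sum_e_reciprocal d g by (simp add: mult_ac)
  have "gauss * (\<Sum>m\<in>UNIV. \<eta> (sqnorm m) * e (dot m z))
      = (\<Sum>u\<in>UNIV - {0}. \<eta> u * e (- sqnorm z / (4 * u))) * gauss ^ CARD('n)"
    unfolding chi_transform by (simp add: chi_power d del: power_Suc)
  also have "\<dots> = gauss * (\<eta> (-1) * \<eta> (sqnorm z) * gauss ^ (2 * k))"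
    unfolding sum_chi_e_reciprocal d by simp
  finally show ?C using gauss_nonzero unfolding g by (simp add: mult_ac)
qed

end

section \<open>The spectral bound\<close>

context additive_character
begin

text \<open>The bound is a spectral one: \<open>lam\<close> lists the eigenvalues of the translation-invariant
  kernel \<open>K - 1/q\<close>, and the eigenvalue of the constant function is treated apart.\<close>
lemma kernel_sum_bound:
  fixes A :: "('a ^ 'n) set" and K lam :: "'a \<Rightarrow> real" and L :: real
  defines "q \<equiv> real CARD('a)" and "N \<equiv> real (card A)"
  assumes transform: "\<And>z :: 'a ^ 'n. (\<Sum>m\<in>UNIV. of_real (lam (sqnorm m)) * e (dot m z))
      = of_real (K (sqnorm z) - 1 / q)"
    and bound: "\<And>t. lam t \<le> L"
  shows "(\<Sum>x\<in>A. \<Sum>y\<in>A. K (fdist x y)) \<le> N\<^sup>2 / q + (lam 0 - L) * N\<^sup>2 + L * q ^ CARD('n) * N"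
proof -
  \<comment> \<open>Unnormalised Fourier transform of the indicator of \<open>A\<close>.\<close>
  define F where "F = (\<lambda>m. \<Sum>x\<in>A. e (dot m x))"
  have F: "complex_of_real ((norm (F m))\<^sup>2) = (\<Sum>x\<in>A. \<Sum>y\<in>A. e (dot m (x - y)))" for m
  proof -
    have "complex_of_real ((norm (F m))\<^sup>2) = F m * cnj (F m)" by (rule complex_norm_square)
    also have "\<dots> = (\<Sum>x\<in>A. \<Sum>y\<in>A. e (dot m x) * e (- dot m y))"
      by (simp add: F_def sum_product e_minus)
    finally show ?thesis by (simp add: dot_diff_right flip: e_add)
  qed
  have expand: "(\<Sum>m\<in>UNIV. complex_of_real (c m * (norm (F m))\<^sup>2))
      = (\<Sum>x\<in>A. \<Sum>y\<in>A. \<Sum>m\<in>UNIV. of_real (c m) * e (dot m (x - y)))" for c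
    unfolding of_real_mult F sum_distrib_left
    by (subst sum.swap) (intro sum.cong refl sum.swap)
  have "complex_of_real (\<Sum>m\<in>UNIV. lam (sqnorm m) * (norm (F m))\<^sup>2)
      = (\<Sum>x\<in>A. \<Sum>y\<in>A. of_real (K (fdist x y) - 1 / q))"
    unfolding of_real_sum expand transform fdist_eq_sqnorm ..
  also have "\<dots> = of_real ((\<Sum>x\<in>A. \<Sum>y\<in>A. K (fdist x y)) - N\<^sup>2 / q)"
    by (simp add: sum_subtractf N_def power2_eq_square)
  finally have 1: "(\<Sum>m\<in>UNIV. lam (sqnorm m) * (norm (F m))\<^sup>2)
      = (\<Sum>x\<in>A. \<Sum>y\<in>A. K (fdist x y)) - N\<^sup>2 / q"
    by (simp only: of_real_eq_iff)
  \<comment> \<open>Parseval: the same expansion with constant weight 1, where orthogonality leaves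
    the diagonal.\<close>
  have "complex_of_real (\<Sum>m\<in>UNIV. 1 * (norm (F m))\<^sup>2)
      = (\<Sum>x\<in>A. \<Sum>y\<in>A. if y = x then of_nat CARD('a) ^ CARD('n) else 0)"
    unfolding of_real_sum expand by (auto simp: sum_e_dot intro!: sum.cong)
  also have "\<dots> = of_real (q ^ CARD('n) * N)"
    by (simp add: q_def N_def)
  finally have 2: "(\<Sum>m\<in>UNIV. (norm (F m))\<^sup>2) = q ^ CARD('n) * N"
    by (simp only: of_real_eq_iff mult_1)
  have F0: "norm (F 0) = N" by (simp add: F_def N_def)
  \<comment> \<open>The frequency 0 keeps its exact weight \<open>lam 0\<close>; replacing it by
    \<open>L\<close> as well would lose the term \<open>(lam 0 - L) * N\<^sup>2\<close>.\<close>
  have "(\<Sum>m\<in>UNIV. lam (sqnorm m) * (norm (F m))\<^sup>2)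
      = lam 0 * N\<^sup>2 + (\<Sum>m\<in>UNIV - {0}. lam (sqnorm m) * (norm (F m))\<^sup>2)"
    by (subst sum.remove[of UNIV 0]) (auto simp: F0)
  also have "(\<Sum>m\<in>UNIV - {0}. lam (sqnorm m) * (norm (F m))\<^sup>2) \<le> (\<Sum>m\<in>UNIV - {0}. L * (norm (F m))\<^sup>2)"
    by (intro sum_mono mult_right_mono bound) auto
  also have "\<dots> = L * (q ^ CARD('n) * N - N\<^sup>2)"
    using sum.remove[of UNIV 0 "\<lambda>m. (norm (F m))\<^sup>2"] 2 F0 by (simp flip: sum_distrib_left)
  finally show ?thesis unfolding 1 by (simp add: algebra_simps)
qed

end

section \<open>From pair counts to kernel sums\<close>

text \<open>The indicator of \<open>qchar t \<in> {0, 1}\<close> is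
  \<open>(1 + qchar t + [t = 0]) / 2\<close>.\<close>

lemma SQ_ZR_eq:
  fixes A :: "('a::{finite,field} ^ 'n) set"
  shows "real (SQ A + ZR A) = (real (card A))\<^sup>2 / 2 +
    (\<Sum>x\<in>A. \<Sum>y\<in>A. real_of_int (qchar (fdist x y)) + of_bool (fdist x y = 0)) / 2"
proof -
  have count: "real (card {(x, y). x \<in> A \<and> y \<in> A \<and> P x y}) = (\<Sum>x\<in>A. \<Sum>y\<in>A. of_bool (P x y))" for P
  proof -
    have "{(x, y). x \<in> A \<and> y \<in> A \<and> P x y} = {p \<in> A \<times> A. case p of (x, y) \<Rightarrow> P x y}" by auto
    moreover have "real (card {p \<in> A \<times> A. case p of (x, y) \<Rightarrow> P x y})
        = (\<Sum>p\<in>A \<times> A. of_bool (case p of (x, y) \<Rightarrow> P x y))"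
      by (simp only: sum.If_cases[OF finite] of_bool_def) (simp add: Int_def)
    ultimately show ?thesis
      by (simp only: sum.cartesian_product case_prod_unfold)
  qed
  have "real (SQ A + ZR A)
      = (\<Sum>x\<in>A. \<Sum>y\<in>A. of_bool (qchar (fdist x y) = 1) + of_bool (qchar (fdist x y) = 0))"
    unfolding SQ_def ZR_def by (simp add: count sum.distrib)
  also have "\<dots> = (\<Sum>x\<in>A. \<Sum>y\<in>A. 1 / 2 + (real_of_int (qchar (fdist x y)) + of_bool (fdist x y = 0)) / 2)"
    by (intro sum.cong refl) (simp add: qchar_def)
  also have "\<dots> = (real (card A))\<^sup>2 / 2 +
      (\<Sum>x\<in>A. \<Sum>y\<in>A. real_of_int (qchar (fdist x y)) + of_bool (fdist x y = 0)) / 2"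
    by (simp add: sum.distrib power2_eq_square flip: sum_divide_distrib)
  finally show ?thesis .
qed

context additive_character
begin

lemma SQ_ZR_bound_odd:
  fixes A :: "('a ^ 'n) set" and L :: real
  defines "q \<equiv> real CARD('a)" and "N \<equiv> real (card A)" and "\<delta> \<equiv> real_of_int (qchar (-1 :: 'a))"
  assumes d: "CARD('n) = 2 * k + 1"
    and bound: "\<And>t :: 'a. \<delta> ^ k * (ramanujan t + qchar t) \<le> L"
  shows "real (SQ A + ZR A) \<le> N\<^sup>2 / 2 + N\<^sup>2 / (2 * q)
    + (\<delta> ^ k * (q - 1) - L) * N\<^sup>2 / (2 * q ^ (k + 1)) + L * q ^ k * N / 2"
proof -
  have q: "q > 0" by (simp add: q_def)
  \<comment> \<open>Since odd dimension exchanges the two functions, \<open>ramanujan\<close>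
    produces the term \<open>qchar\<close> of the kernel and \<open>qchar\<close> produces
    \<open>ramanujan / q = [t = 0] - 1/q\<close>.\<close>
  define lam where "lam = (\<lambda>t :: 'a. \<delta> ^ k * (ramanujan t + qchar t) / q ^ (k + 1))"
  have \<delta>: "\<delta> ^ k * \<delta> ^ k = 1"
    unfolding \<delta>_def by (auto simp: qchar_def simp flip: power_mult_distrib)
  have "(\<Sum>x\<in>A. \<Sum>y\<in>A. real_of_int (qchar (fdist x y)) + of_bool (fdist x y = 0))
      \<le> N\<^sup>2 / q + (lam 0 - L / q ^ (k + 1)) * N\<^sup>2 + L / q ^ (k + 1) * q ^ CARD('n) * N"
    unfolding q_def N_def
  proof (rule kernel_sum_bound[where lam = lam and L = "L / real CARD('a) ^ (k + 1)"
        and K = "\<lambda>t. real_of_int (qchar t) + of_bool (t = 0)"])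
    fix z :: "'a ^ 'n"
    have "(\<Sum>m\<in>UNIV. of_real (lam (sqnorm m)) * e (dot m z))
        = of_real (\<delta> ^ k / q ^ (k + 1)) * ((\<Sum>m\<in>UNIV. of_real (ramanujan (sqnorm m)) * e (dot m z))
          + (\<Sum>m\<in>UNIV. \<eta> (sqnorm m) * e (dot m z)))"
      unfolding lam_def sum_distrib_left sum.distrib[symmetric]
      by (intro sum.cong refl) (simp add: algebra_simps add_divide_distrib)
    also have "\<dots> = of_real (\<delta> ^ k / q ^ (k + 1) * (\<delta> ^ k * q ^ (k + 1) * qchar (sqnorm z)
        + \<delta> ^ k * q ^ k * ramanujan (sqnorm z)))"
      unfolding transforms_odd[OF d] by (simp add: \<delta>_def q_def)
    also have "\<delta> ^ k / q ^ (k + 1) * (\<delta> ^ k * q ^ (k + 1) * qchar (sqnorm z)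
        + \<delta> ^ k * q ^ k * ramanujan (sqnorm z))
        = (\<delta> ^ k * \<delta> ^ k) * (qchar (sqnorm z) + ramanujan (sqnorm z) / q)"
      using q by (simp add: field_simps)
    also have "\<dots> = real_of_int (qchar (sqnorm z)) + of_bool (sqnorm z = 0) - 1 / real CARD('a)"
      unfolding \<delta> using q by (simp add: ramanujan_def q_def field_simps)
    finally show "(\<Sum>m\<in>UNIV. of_real (lam (sqnorm m)) * e (dot m z))
      = of_real (real_of_int (qchar (sqnorm z)) + of_bool (sqnorm z = 0) - 1 / real CARD('a))" .
  next
    show "lam t \<le> L / real CARD('a) ^ (k + 1)" for t
      unfolding lam_def q_def[symmetric] using q by (intro divide_right_mono bound) simp
  qed
  also have "lam 0 = \<delta> ^ k * (q - 1) / q ^ (k + 1)"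
    by (simp add: lam_def ramanujan_def qchar_def q_def)
  also have "L / q ^ (k + 1) * q ^ CARD('n) = L * q ^ k"
    using q by (simp add: d power_add power_mult power2_eq_square power_mult_distrib)
  finally show ?thesis
    unfolding SQ_ZR_eq N_def[symmetric] by (simp add: diff_divide_distrib left_diff_distrib add_divide_distrib)
qed

lemma SQ_ZR_bound_even:
  fixes A :: "('a ^ 'n) set" and L :: real
  defines "q \<equiv> real CARD('a)" and "N \<equiv> real (card A)" and "\<delta> \<equiv> real_of_int (qchar (-1 :: 'a))"
  assumes d: "CARD('n) = 2 * k"
    and bound: "\<And>t :: 'a. \<delta> ^ k * (\<delta> * qchar t + ramanujan t / q) \<le> L"
  shows "real (SQ A + ZR A) \<le> N\<^sup>2 / 2 + N\<^sup>2 / (2 * q)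
    + (\<delta> ^ k * (1 - 1 / q) - L) * N\<^sup>2 / (2 * q ^ k) + L * q ^ k * N / 2"
proof -
  have q: "q > 0" by (simp add: q_def)
  \<comment> \<open>Here each summand reproduces itself; the inner \<open>\<delta>\<close> cancels
    the additional sign in the transform of \<open>qchar\<close>.\<close>
  define lam where "lam = (\<lambda>t :: 'a. \<delta> ^ k * (\<delta> * qchar t + ramanujan t / q) / q ^ k)"
  have \<delta>: "\<delta> ^ k * \<delta> ^ k = 1" "\<delta> * \<delta> = 1"
    unfolding \<delta>_def by (auto simp: qchar_def simp flip: power_mult_distrib)
  have "(\<Sum>x\<in>A. \<Sum>y\<in>A. real_of_int (qchar (fdist x y)) + of_bool (fdist x y = 0))
      \<le> N\<^sup>2 / q + (lam 0 - L / q ^ k) * N\<^sup>2 + L / q ^ k * q ^ CARD('n) * N"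
    unfolding q_def N_def
  proof (rule kernel_sum_bound[where lam = lam and L = "L / real CARD('a) ^ k"
        and K = "\<lambda>t. real_of_int (qchar t) + of_bool (t = 0)"])
    fix z :: "'a ^ 'n"
    have "(\<Sum>m\<in>UNIV. of_real (lam (sqnorm m)) * e (dot m z))
        = of_real (\<delta> ^ k / q ^ k) * (of_real (1 / q) * (\<Sum>m\<in>UNIV. of_real (ramanujan (sqnorm m)) * e (dot m z))
          + of_real \<delta> * (\<Sum>m\<in>UNIV. \<eta> (sqnorm m) * e (dot m z)))"
      unfolding lam_def sum_distrib_left sum.distrib[symmetric]
      by (intro sum.cong refl) (simp add: algebra_simps add_divide_distrib)
    also have "\<dots> = of_real (\<delta> ^ k / q ^ k * (1 / q * (\<delta> ^ k * q ^ k * ramanujan (sqnorm z))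
        + \<delta> * (\<delta> ^ (k + 1) * q ^ k * qchar (sqnorm z))))"
      unfolding transforms_even[OF d] by (simp add: \<delta>_def q_def)
    also have "\<delta> ^ k / q ^ k * (1 / q * (\<delta> ^ k * q ^ k * ramanujan (sqnorm z))
        + \<delta> * (\<delta> ^ (k + 1) * q ^ k * qchar (sqnorm z)))
        = (\<delta> ^ k * \<delta> ^ k) * ((\<delta> * \<delta>) * qchar (sqnorm z) + ramanujan (sqnorm z) / q)"
      using q by (simp add: field_simps)
    also have "\<dots> = real_of_int (qchar (sqnorm z)) + of_bool (sqnorm z = 0) - 1 / real CARD('a)"
      unfolding \<delta> using q by (simp add: ramanujan_def q_def field_simps)
    finally show "(\<Sum>m\<in>UNIV. of_real (lam (sqnorm m)) * e (dot m z))
      = of_real (real_of_int (qchar (sqnorm z)) + of_bool (sqnorm z = 0) - 1 / real CARD('a))" .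
  next
    show "lam t \<le> L / real CARD('a) ^ k" for t
      unfolding lam_def q_def[symmetric] using q by (intro divide_right_mono bound) simp
  qed
  also have "lam 0 = \<delta> ^ k * (1 - 1 / q) / q ^ k"
    using q by (simp add: lam_def ramanujan_def qchar_def q_def diff_divide_distrib)
  also have "L / q ^ k * q ^ CARD('n) = L * q ^ k"
    using q by (simp add: d power_mult power2_eq_square power_mult_distrib)
  finally show ?thesis
    unfolding SQ_ZR_eq N_def[symmetric] by (simp add: diff_divide_distrib left_diff_distrib add_divide_distrib)
qed

end

section \<open>The four residue classes and their largest eigenvalues\<close>

theorem theorem1p2:
  fixes A :: "('a::{finite,field} ^ 'n) set"
  defines "q \<equiv> real CARD('a)"
  defines "d \<equiv> CARD('n)"
  defines "N \<equiv> real (card A)"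
  assumes "odd CARD('a)"
  shows
   "(d mod 4 = 3 \<and> CARD('a) mod 4 = 3 \<longrightarrow>
      real (SQ A + ZR A) \<le> N^2/2 + N^2/(2*q) - N^2/(2*q^((d-1) div 2))
        - N^2/(2*q^((d+1) div 2)) + q^((d-1) div 2) * N)
  \<and> (d mod 4 = 1 \<or> (d mod 4 = 3 \<and> CARD('a) mod 4 = 1) \<longrightarrow>
      real (SQ A + ZR A) \<le> N^2/2 + N^2/(2*q) + q^((d+1) div 2) * N / 2
        - q^((d-1) div 2) * N / 2)
  \<and> (d mod 4 = 2 \<and> CARD('a) mod 4 = 3 \<longrightarrow>
      real (SQ A + ZR A) \<le> N^2/2 + N^2/(2*q) - N^2/q^(d div 2)
        + q^(d div 2) * N / 2 + q^((d-2) div 2) * N / 2)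
  \<and> (d mod 4 = 0 \<or> (d mod 4 = 2 \<and> CARD('a) mod 4 = 1) \<longrightarrow>
      real (SQ A + ZR A) \<le> N^2/2 + N^2/(2*q) + q^(d div 2) * N / 2
        - q^((d-2) div 2) * N / 2)"
proof -
  have two: "(2::'a) \<noteq> 0" using assms by (intro odd_card_two_neq_zero)
  obtain e :: "'a \<Rightarrow> complex" where "\<And>x y. e (x + y) = e x * e y" "\<And>x. norm (e x) = 1" "e 1 \<noteq> 1"
    using nontrivial_additive_character_exists[where 'a = 'a] by metis
  then interpret additive_character e by unfold_locales (use two in auto)
  define \<delta> where "\<delta> = real_of_int (qchar (-1 :: 'a))"
  have \<delta>: "\<delta> = (if CARD('a) mod 4 = 1 then 1 else -1)"
    unfolding \<delta>_def qchar_minus_1[OF two] by simp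
  have "CARD('a) \<noteq> 1" using card_qchar_eq(2)[OF two] card_1_singletonE[of "UNIV :: 'a set"]
    by (metis UNIV_I singletonD zero_neq_one)
  then have q: "q \<ge> 3" using \<open>odd CARD('a)\<close> unfolding q_def
    by (cases "CARD('a)") (auto elim!: oddE)
  have chi_cases: "qchar t = 0 \<and> ramanujan t = q - 1 \<or> (qchar t = 1 \<or> qchar t = -1) \<and> ramanujan t = -1" for t :: 'a
    by (simp add: qchar_def ramanujan_def q_def)
  show ?thesis
  proof (intro conjI impI)
    assume *: "d mod 4 = 3 \<and> CARD('a) mod 4 = 3"
    define k where "k = (d - 1) div 2"
    have "d mod 4 = 3" using * by blast
    then have k: "d = 2 * k + 1" "(d + 1) div 2 = k + 1" "odd k"
      unfolding k_def by presburger+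
    have [simp]: "\<delta> ^ k = -1" using * k(3) by (simp add: \<delta>)
    \<comment> \<open>With sign \<open>-1\<close> the maximum 2 occurs at nonsquares; squares give 0
      and \<open>t = 0\<close> gives \<open>1 - q\<close>.\<close>
    have "\<delta> ^ k * (ramanujan t + qchar t) \<le> 2" for t :: 'a
      using chi_cases[of t] q by auto
    from SQ_ZR_bound_odd[where A = A, OF k(1)[unfolded d_def], folded \<delta>_def q_def N_def, OF this]
    have "real (SQ A + ZR A) \<le> N\<^sup>2 / 2 + N\<^sup>2 / (2 * q)
        + (- 1 - q) * N\<^sup>2 / (2 * q ^ (k + 1)) + q ^ k * N" by simp
    also have "(- 1 - q) * N\<^sup>2 / (2 * q ^ (k + 1)) = - N\<^sup>2 / (2 * q ^ k) - N\<^sup>2 / (2 * q ^ (k + 1))"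
      using q by (simp add: field_simps)
    finally show "real (SQ A + ZR A) \<le> N^2/2 + N^2/(2*q) - N^2/(2*q^((d-1) div 2))
        - N^2/(2*q^((d+1) div 2)) + q^((d-1) div 2) * N"
      unfolding k(2) k_def[symmetric] by simp
  next
    assume *: "d mod 4 = 1 \<or> (d mod 4 = 3 \<and> CARD('a) mod 4 = 1)"
    define k where "k = (d - 1) div 2"
    have "d mod 4 = 1 \<or> d mod 4 = 3" using * by blast
    then have k: "d = 2 * k + 1" "(d + 1) div 2 = k + 1" "d mod 4 = 1 \<longrightarrow> even k"
      unfolding k_def by presburger+
    have [simp]: "\<delta> ^ k = 1" using k(3) * by (auto simp: \<delta>)
    \<comment> \<open>The maximum is the value at \<open>t = 0\<close>, so the correction of order
      \<open>N\<^sup>2\<close> cancels.\<close>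
    have "\<delta> ^ k * (ramanujan t + qchar t) \<le> q - 1" for t :: 'a
      using chi_cases[of t] q by auto
    from SQ_ZR_bound_odd[where A = A, OF k(1)[unfolded d_def], folded \<delta>_def q_def N_def, OF this]
    show "real (SQ A + ZR A) \<le> N^2/2 + N^2/(2*q) + q^((d+1) div 2) * N / 2
        - q^((d-1) div 2) * N / 2"
      unfolding k(2) k_def[symmetric] by (simp add: left_diff_distrib diff_divide_distrib)
  next
    assume *: "d mod 4 = 2 \<and> CARD('a) mod 4 = 3"
    define k where "k = d div 2"
    have "d mod 4 = 2" using * by blast
    then have k: "d = 2 * k" "(d - 2) div 2 = k - 1" "k > 0" "odd k"
      unfolding k_def by presburger+
    have \<delta>1: "\<delta> = -1" and [simp]: "\<delta> ^ k = -1" using * k(4) by (simp_all add: \<delta>)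
    \<comment> \<open>Nonzero squares attain the maximum. Subtracting it from the value
      \<open>-(1 - 1 / q)\<close> at 0 gives \<open>-2\<close>, hence the term
      \<open>- N\<^sup>2 / q ^ k\<close>.\<close>
    have "qchar t - ramanujan t / q \<le> 1 + 1 / q" for t :: 'a
      using chi_cases[of t] q by (auto simp: field_simps)
    then have "\<delta> ^ k * (\<delta> * qchar t + ramanujan t / q) \<le> 1 + 1 / q" for t :: 'a
      unfolding \<open>\<delta> ^ k = -1\<close> by (simp add: \<delta>1)
    from SQ_ZR_bound_even[where A = A, OF k(1)[unfolded d_def], folded \<delta>_def q_def N_def, OF this]
    have "real (SQ A + ZR A) \<le> N\<^sup>2 / 2 + N\<^sup>2 / (2 * q)
        - N\<^sup>2 / q ^ k + (1 + 1 / q) * q ^ k * N / 2" by simp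
    also have "(1 + 1 / q) * q ^ k * N / 2 = q ^ k * N / 2 + q ^ (k - 1) * N / 2"
      using q k(3) by (cases k) (simp_all add: field_simps)
    finally show "real (SQ A + ZR A) \<le> N^2/2 + N^2/(2*q) - N^2/q^(d div 2)
        + q^(d div 2) * N / 2 + q^((d-2) div 2) * N / 2"
      unfolding k(2) k_def[symmetric] by simp
  next
    assume *: "d mod 4 = 0 \<or> (d mod 4 = 2 \<and> CARD('a) mod 4 = 1)"
    define k where "k = d div 2"
    \<comment> \<open>Positivity excludes \<open>d = 0\<close>, where \<open>(d - 2) div 2\<close>
      and \<open>k - 1\<close> would be truncated.\<close>
    have "d > 0" by (simp add: d_def)
    moreover have "d mod 4 = 0 \<or> d mod 4 = 2" using * by blast
    ultimately have k: "d = 2 * k" "(d - 2) div 2 = k - 1" "k > 0" "d mod 4 = 0 \<longrightarrow> even k"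
      unfolding k_def by presburger+
    have [simp]: "\<delta> ^ k = 1" using k(4) * by (auto simp: \<delta>)
    have "\<delta> = 1 \<or> \<delta> = -1" by (simp add: \<delta>)
    \<comment> \<open>The maximum is attained at \<open>t = 0\<close> and wherever
      \<open>\<delta> * qchar t = 1\<close>; again the \<open>N\<^sup>2\<close> correction
      cancels.\<close>
    then have "\<delta> * qchar t + ramanujan t / q \<le> 1 - 1 / q" for t :: 'a
      using chi_cases[of t] q by (auto simp: field_simps)
    then have "\<delta> ^ k * (\<delta> * qchar t + ramanujan t / q) \<le> 1 - 1 / q" for t :: 'a
      by simp
    from SQ_ZR_bound_even[where A = A, OF k(1)[unfolded d_def], folded \<delta>_def q_def N_def, OF this]
    have "real (SQ A + ZR A) \<le> N\<^sup>2 / 2 + N\<^sup>2 / (2 * q) + (1 - 1 / q) * q ^ k * N / 2" by simp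
    also have "(1 - 1 / q) * q ^ k * N / 2 = q ^ k * N / 2 - q ^ (k - 1) * N / 2"
      using q k(3) by (cases k) (simp_all add: field_simps)
    finally show "real (SQ A + ZR A) \<le> N^2/2 + N^2/(2*q) + q^(d div 2) * N / 2
        - q^((d-2) div 2) * N / 2"
      unfolding k(2) k_def[symmetric] by simp
  qed
qed

end
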